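(* There is an absolute constant $K>0$ such that for every $n\ge 1$ and every $f:\{0,1\}^n\to\{0,1\}$, $$\mathrm{EC}(f)\le K\cdot \mathrm{FC}(f)^{3/2}\quad\text{and}\quad \mathrm{EC}(f)\le K\cdot R(f)^{3/2},$$ and moreover $\mathrm{FC}(f)^{3/2}\le K\cdot R(f)^{3/2}$; that is, $\mathrm{EC}(f)=O(\mathrm{FC}(f)^{3/2})=O(R(f)^{3/2})$.
   Context: Let $f:\{0,1\}^n\to\{0,1\}$ and $[n]=\{1,\dots,n\}$. The expectational certificate complexity $\mathrm{EC}(f)$ is the optimal value of the following program over families $\{w_x\}_{x\in\{0,1\}^n}$, $w_x\in\mathbb R^n$: minimize $\max_{x}\sum_{i=1}^n w_x(i)$ subject to $\sum_{i:x_i\ne y_i} w_x(i)w_y(i)\ge 1$ for all $x,y$ with $f(x)\ne f(y)$, and $0\le w_x(i)\le 1$ for all $x\in\{0,1\}^n$, $i\in[n]$. Fractional certificate complexity: for $x\in\{0,1\}^n$, $\mathrm{FC}(f,x)$ is the optimal value of the linear program: minimize $\sum_{i\in[n]}v_x(i)$ over $v_x\in\mathbb R^n$ with $v_x(i)\ge 0$ for all $i$, subject to $\sum_{i:x_i\ne y_i}v_x(i)\ge 1$ for all $y$ with $f(y)\ne f(x)$. $\mathrm{FC}(f)=\max_{x}\mathrm{FC}(f,x)$. Randomized query complexity: a randomized query algorithm $\mathcal A$ is given query access to $x\in\{0,1\}^n$ and a random string $r$; with one query it learns one bit $x_i$ of its choice (adaptively), and finally outputs a bit $\mathcal A(x,r)$.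 (Equivalently, it is a probability distribution over deterministic decision trees.) Its worst-case complexity is the maximum over $x$ and $r$ of the number of queries made. $R(f)$ is the minimum worst-case complexity of a randomized query algorithm $\mathcal A$ with $\Pr_r[\mathcal A(x,r)\ne f(x)]\le 1/3$ for every $x\in\{0,1\}^n$. *)

theory Defs
  imports "HOL-Probability.Probability"
begin

text \<open>
  Points of the Boolean cube are functions on the index set, fixed to \<^term>\<open>undefined\<close> outside
  it, and Boolean functions are total functions of which only the values on the cube matter.
  The dimension is thereby an ordinary natural number.
\<close>

definition cube :: "nat \<Rightarrow> (nat \<Rightarrow> bool) set" where
  "cube n = {1..n} \<rightarrow>\<^sub>E UNIV"


text \<open>
  In both programs below the all-ones weights are feasible and the objective is nonnegative, so
  the real infimum is taken over a nonempty set bounded below.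
\<close>

definition EC_feasible ::
    "nat \<Rightarrow> ((nat \<Rightarrow> bool) \<Rightarrow> bool) \<Rightarrow> ((nat \<Rightarrow> bool) \<Rightarrow> nat \<Rightarrow> real) \<Rightarrow> bool" where
  "EC_feasible n f w \<longleftrightarrow>
     (\<forall>x\<in>cube n. \<forall>y\<in>cube n. f x \<noteq> f y \<longrightarrow>
        (\<Sum>i | i \<in> {1..n} \<and> x i \<noteq> y i. w x i * w y i) \<ge> 1) \<and>
     (\<forall>x\<in>cube n. \<forall>i\<in>{1..n}. 0 \<le> w x i \<and> w x i \<le> 1)"

definition EC :: "nat \<Rightarrow> ((nat \<Rightarrow> bool) \<Rightarrow> bool) \<Rightarrow> real" where
  "EC n f = Inf {Max ((\<lambda>x. \<Sum>i=1..n. w x i) ` cube n) |w. EC_feasible n f w}"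

definition FC_feasible ::
    "nat \<Rightarrow> ((nat \<Rightarrow> bool) \<Rightarrow> bool) \<Rightarrow> (nat \<Rightarrow> bool) \<Rightarrow> (nat \<Rightarrow> real) \<Rightarrow> bool" where
  "FC_feasible n f x v \<longleftrightarrow>
     (\<forall>i\<in>{1..n}. 0 \<le> v i) \<and>
     (\<forall>y\<in>cube n. f y \<noteq> f x \<longrightarrow> (\<Sum>i | i \<in> {1..n} \<and> x i \<noteq> y i. v i) \<ge> 1)"

definition FC_at :: "nat \<Rightarrow> ((nat \<Rightarrow> bool) \<Rightarrow> bool) \<Rightarrow> (nat \<Rightarrow> bool) \<Rightarrow> real" where
  "FC_at n f x = Inf {\<Sum>i=1..n. v i |v. FC_feasible n f x v}"

definition FC :: "nat \<Rightarrow> ((nat \<Rightarrow> bool) \<Rightarrow> bool) \<Rightarrow> real" where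
  "FC n f = Max (FC_at n f ` cube n)"


text \<open>
  The first subtree of a query node is followed if the queried bit is 0, the second if it is 1.
\<close>

datatype (queried: 'i) dtree = Leaf bool | Query 'i "'i dtree" "'i dtree"

primrec dtree_output :: "'i dtree \<Rightarrow> ('i \<Rightarrow> bool) \<Rightarrow> bool" where
  "dtree_output (Leaf b) x = b"
| "dtree_output (Query i T0 T1) x = (if x i then dtree_output T1 x else dtree_output T0 x)"

primrec dtree_cost :: "'i dtree \<Rightarrow> ('i \<Rightarrow> bool) \<Rightarrow> nat" where
  "dtree_cost (Leaf b) x = 0"
| "dtree_cost (Query i T0 T1) x = Suc (if x i then dtree_cost T1 x else dtree_cost T0 x)"

text \<open>
  A randomized query algorithm is a probability distribution over decision trees. Since
  \<^typ>\<open>nat dtree\<close> is countable, restricting to discrete distributions loses no generality.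
\<close>

definition randomized_alg :: "nat \<Rightarrow> nat dtree pmf \<Rightarrow> bool" where
  "randomized_alg n A \<longleftrightarrow> (\<forall>T\<in>set_pmf A. queried T \<subseteq> {1..n})"

definition worst_case_cost :: "nat \<Rightarrow> nat dtree pmf \<Rightarrow> enat" where
  "worst_case_cost n A = (SUP T\<in>set_pmf A. SUP x\<in>cube n. enat (dtree_cost T x))"

definition computes :: "nat \<Rightarrow> nat dtree pmf \<Rightarrow> ((nat \<Rightarrow> bool) \<Rightarrow> bool) \<Rightarrow> bool" where
  "computes n A f \<longleftrightarrow>
     (\<forall>x\<in>cube n. measure_pmf.prob A {T. dtree_output T x \<noteq> f x} \<le> 1 / 3)"

text \<open>
  Algorithms of infinite worst-case cost are irrelevant for the minimum: querying all \<open>n\<close> bits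
  computes \<open>f\<close> with cost \<open>n\<close>.
\<close>

definition R :: "nat \<Rightarrow> ((nat \<Rightarrow> bool) \<Rightarrow> bool) \<Rightarrow> nat" where
  "R n f = (LEAST d. \<exists>A. randomized_alg n A \<and> computes n A f \<and> worst_case_cost n A = enat d)"

end

theory Submission
  imports Defs
begin

text \<open>
  Let \<open>v\<^sub>x\<close> be fractional certificates. If \<open>f x \<noteq> f y\<close>, let \<open>z\<close> follow \<open>y\<close> where \<open>v\<^sub>x \<le> v\<^sub>y\<close> and
  \<open>x\<close> elsewhere. As \<open>f z\<close> differs from \<open>f x\<close> or from \<open>f y\<close>, one of the two certificates shows
  that \<open>min (v\<^sub>x i) (v\<^sub>y i)\<close> sums to at least 1 over the positions where \<open>x\<close> and \<open>y\<close> differ. Since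
  \<open>min a b \<le> sqrt (a * b)\<close>, the square roots of the \<open>v\<^sub>x\<close> are feasible for \<open>EC\<close>. To control the
  sum of the square roots, small weights are removed first: a minimal sensitive block has at most
  \<open>FC f\<close> elements, because after flipping it each of its positions is sensitive. Hence weights
  below \<open>1 / (2 * FC f)\<close> contribute at most 1/2 to it, and doubling the others restores
  feasibility; after that, taking square roots costs at most a factor \<open>sqrt (FC f)\<close>.

  For the bound by \<open>R\<close>, three times the probability that position \<open>i\<close> is queried on input \<open>x\<close> is a
  fractional certificate for \<open>x\<close>.
\<close>

section \<open>Fractional certificates\<close>

abbreviation diff :: "nat \<Rightarrow> (nat \<Rightarrow> bool) \<Rightarrow> (nat \<Rightarrow> bool) \<Rightarrow> nat set" where
  "diff n x y \<equiv> {i. i \<in> {1..n} \<and> x i \<noteq> y i}"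

lemma finite_cube: "finite (cube n)"
  unfolding cube_def by (intro finite_PiE) auto

lemma cube_nonempty: "cube n \<noteq> {}"
  unfolding cube_def by (simp add: PiE_eq_empty_iff)

lemma fun_upd_in_cube: "x \<in> cube n \<Longrightarrow> i \<in> {1..n} \<Longrightarrow> x(i := b) \<in> cube n"
  unfolding cube_def by (auto simp: PiE_def extensional_def)

lemma if_in_cube: "x \<in> cube n \<Longrightarrow> y \<in> cube n \<Longrightarrow> (\<lambda>i. if P i then x i else y i) \<in> cube n"
  unfolding cube_def by (auto simp: PiE_def extensional_def)

lemma FC_feasible_sum_ge_1:
  "FC_feasible n f x v \<Longrightarrow> y \<in> cube n \<Longrightarrow> f y \<noteq> f x \<Longrightarrow> 1 \<le> (\<Sum>i\<in>diff n x y. v i)"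
  unfolding FC_feasible_def by blast

lemma bdd_below_FC_values: "bdd_below {\<Sum>i=1..n. v i |v. FC_feasible n f x v}"
  by (rule bdd_belowI[of _ 0]) (auto simp: FC_feasible_def intro!: sum_nonneg)

text \<open>Makes the set whose infimum is \<open>FC_at\<close> nonempty. Distinct points of the
  cube differ inside \<open>{1..n}\<close>, because outside it both are
  \<open>undefined\<close>.\<close>

lemma FC_feasible_one:
  assumes "x \<in> cube n"
  shows "FC_feasible n f x (\<lambda>i. 1)"
  unfolding FC_feasible_def
proof (intro conjI ballI impI)
  fix y assume y: "y \<in> cube n" "f y \<noteq> f x"
  have "diff n x y \<noteq> {}"
  proof
    assume "diff n x y = {}"
    then have "x = y"
      using assms y(1) unfolding cube_def by (intro PiE_ext) auto
    then show False using y(2) by simp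
  qed
  then have "0 < card (diff n x y)" by (subst card_gt_0_iff) simp
  then show "(\<Sum>i\<in>diff n x y. 1) \<ge> (1::real)" by simp
qed simp

lemma FC_at_le: "FC_feasible n f x v \<Longrightarrow> FC_at n f x \<le> (\<Sum>i=1..n. v i)"
  unfolding FC_at_def by (intro cInf_lower bdd_below_FC_values) auto

lemma FC_at_greatest:
  assumes "x \<in> cube n" "\<And>v. FC_feasible n f x v \<Longrightarrow> c \<le> (\<Sum>i=1..n. v i)"
  shows "c \<le> FC_at n f x"
  unfolding FC_at_def using assms FC_feasible_one[OF assms(1)] by (intro cInf_greatest) auto

lemma FC_at_approx:
  assumes "x \<in> cube n" "FC_at n f x < c"
  obtains v where "FC_feasible n f x v" "(\<Sum>i=1..n. v i) < c"
  using FC_at_greatest[OF assms(1), of f c] assms(2) by (meson not_le)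

lemma FC_at_le_FC: "x \<in> cube n \<Longrightarrow> FC_at n f x \<le> FC n f"
  unfolding FC_def by (simp add: finite_cube)

lemma FC_nonneg: "0 \<le> FC n f"
proof -
  obtain x where x: "x \<in> cube n" using cube_nonempty by blast
  have "0 \<le> FC_at n f x"
    using x by (rule FC_at_greatest) (auto simp: FC_feasible_def intro!: sum_nonneg)
  then show ?thesis using FC_at_le_FC[OF x, of f] by linarith
qed

lemma FC_ge_1:
  assumes "x \<in> cube n" "y \<in> cube n" "f x \<noteq> f y"
  shows "1 \<le> FC n f"
proof -
  have "1 \<le> FC_at n f x"
  proof (rule FC_at_greatest[OF assms(1)])
    fix v assume v: "FC_feasible n f x v"
    then have "1 \<le> (\<Sum>i\<in>diff n x y. v i)"
      using assms by (intro FC_feasible_sum_ge_1[of n f]) auto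
    also have "\<dots> \<le> (\<Sum>i=1..n. v i)"
      using v unfolding FC_feasible_def by (intro sum_mono2) auto
    finally show "1 \<le> (\<Sum>i=1..n. v i)" .
  qed
  then show ?thesis using FC_at_le_FC[OF assms(1), of f] by linarith
qed

text \<open>A position of weight at least 1 meets the constraint alone, also after capping; if there
  is none, capping changes nothing on the block. This supplies the upper bound 1 on weights in
  \<open>EC\<close>.\<close>

lemma FC_feasible_min_1:
  assumes v: "FC_feasible n f x v"
  shows "FC_feasible n f x (\<lambda>i. min 1 (v i))"
  unfolding FC_feasible_def
proof (intro conjI ballI impI)
  fix i assume "i \<in> {1..n}"
  then show "0 \<le> min 1 (v i)" using v unfolding FC_feasible_def by simp
next
  fix y assume y: "y \<in> cube n" "f y \<noteq> f x"
  have nonneg: "\<And>i. i \<in> diff n x y \<Longrightarrow> 0 \<le> v i"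
    using v unfolding FC_feasible_def by auto
  show "1 \<le> (\<Sum>i\<in>diff n x y. min 1 (v i))"
  proof (cases "\<exists>i\<in>diff n x y. 1 \<le> v i")
    case True
    then obtain i where i: "i \<in> diff n x y" "1 \<le> v i" by blast
    then have "1 = min 1 (v i)" by simp
    also have "\<dots> \<le> (\<Sum>i\<in>diff n x y. min 1 (v i))"
      using nonneg i(1) by (intro member_le_sum) auto
    finally show ?thesis .
  next
    case False
    then have "(\<Sum>i\<in>diff n x y. min 1 (v i)) = (\<Sum>i\<in>diff n x y. v i)"
      by (intro sum.cong) auto
    then show ?thesis using FC_feasible_sum_ge_1[OF v y] by simp
  qed
qed

lemma small_sensitive_block:
  assumes "x \<in> cube n" "y \<in> cube n" "f y \<noteq> f x"
  obtains z where "z \<in> cube n" "f z \<noteq> f x" "diff n x z \<subseteq> diff n x y"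
    "real (card (diff n x z)) \<le> FC n f"
proof -
  let ?P = "\<lambda>z. z \<in> cube n \<and> f z \<noteq> f x \<and> diff n x z \<subseteq> diff n x y"
  have "?P y" using assms by auto
  then obtain z where z: "?P z"
    and least: "\<And>z'. ?P z' \<Longrightarrow> card (diff n x z) \<le> card (diff n x z')"
    using ex_has_least_nat[of ?P y "\<lambda>z. card (diff n x z)"] by blast
  \<comment> \<open>Undoing one flip gives a smaller candidate block, so by minimality
    \<open>f\<close> takes the value \<open>f x\<close> there: every position of the block is
    sensitive at \<open>z\<close>.\<close>
  have flip: "f (z(i := x i)) = f x" if i: "i \<in> diff n x z" for i
  proof (rule ccontr)
    assume "f (z(i := x i)) \<noteq> f x"
    moreover have "diff n x (z(i := x i)) = diff n x z - {i}" using i by auto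
    ultimately have "card (diff n x z) \<le> card (diff n x z - {i})"
      using least[of "z(i := x i)"] z i fun_upd_in_cube[of z n i "x i"] by auto
    moreover have "card (diff n x z - {i}) < card (diff n x z)"
      using i by (intro card_Diff1_less) auto
    ultimately show False by simp
  qed
  \<comment> \<open>The certificates used here are those of \<open>z\<close>, not of
    \<open>x\<close>: each must put weight at least 1 on every position of the block.\<close>
  have "real (card (diff n x z)) \<le> FC_at n f z"
  proof (rule FC_at_greatest)
    show "z \<in> cube n" using z by blast
    fix v assume v: "FC_feasible n f z v"
    have "1 \<le> v i" if i: "i \<in> diff n x z" for i
    proof -
      have "diff n z (z(i := x i)) = {i}" using i by auto
      moreover have "1 \<le> (\<Sum>j\<in>diff n z (z(i := x i)). v j)"
        using v
      proof (rule FC_feasible_sum_ge_1)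
        show "z(i := x i) \<in> cube n" using z i by (intro fun_upd_in_cube) auto
        show "f (z(i := x i)) \<noteq> f z" using flip[OF i] z by metis
      qed
      ultimately show ?thesis by simp
    qed
    then have "real (card (diff n x z)) \<le> (\<Sum>i\<in>diff n x z. v i)"
      using sum_mono[of "diff n x z" "\<lambda>_. 1" v] by simp
    also have "\<dots> \<le> (\<Sum>i=1..n. v i)"
      using v unfolding FC_feasible_def by (intro sum_mono2) auto
    finally show "real (card (diff n x z)) \<le> (\<Sum>i=1..n. v i)" .
  qed
  then have "real (card (diff n x z)) \<le> FC n f"
    using FC_at_le_FC[of z n f] z by linarith
  then show thesis using that z by blast
qed

lemma FC_feasible_remove_small:
  assumes x: "x \<in> cube n" and v: "FC_feasible n f x v" and F: "FC n f \<le> F" "F > 0"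
  shows "FC_feasible n f x (\<lambda>i. if 1 / (2 * F) \<le> v i then 2 * v i else 0)"
    (is "FC_feasible n f x ?u")
  unfolding FC_feasible_def
proof (intro conjI ballI impI)
  fix i assume "i \<in> {1..n}"
  then show "0 \<le> ?u i" using v unfolding FC_feasible_def by simp
next
  fix y assume y: "y \<in> cube n" "f y \<noteq> f x"
  have u_nonneg: "0 \<le> ?u i" if "i \<in> {1..n}" for i
    using v that unfolding FC_feasible_def by simp
  obtain z where z: "z \<in> cube n" "f z \<noteq> f x" "diff n x z \<subseteq> diff n x y"
    and card: "real (card (diff n x z)) \<le> FC n f"
    using small_sensitive_block[OF x y] .
  have "1 \<le> (\<Sum>i\<in>diff n x z. v i)"
    using v z(1,2) by (rule FC_feasible_sum_ge_1)
  also have "\<dots> \<le> (\<Sum>i\<in>diff n x z. 1 / (2 * F) + ?u i / 2)"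
    using F by (intro sum_mono) auto
  also have "\<dots> = real (card (diff n x z)) / (2 * F) + (\<Sum>i\<in>diff n x z. ?u i) / 2"
    by (simp add: sum.distrib sum_divide_distrib)
  \<comment> \<open>The block has at most \<open>F\<close> elements, so the dropped weights amount
    to at most half of the required 1; doubling compensates.\<close>
  also have "\<dots> \<le> 1 / 2 + (\<Sum>i\<in>diff n x z. ?u i) / 2"
    using card F by (simp add: field_simps)
  finally have "1 \<le> (\<Sum>i\<in>diff n x z. ?u i)" by linarith
  also have "\<dots> \<le> (\<Sum>i\<in>diff n x y. ?u i)"
    using z(3) u_nonneg by (intro sum_mono2) auto
  finally show "1 \<le> (\<Sum>i\<in>diff n x y. ?u i)" .
qed

section \<open>Expectational certificates from fractional ones\<close>

lemma sum_min_ge_1: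
  assumes x: "x \<in> cube n" and y: "y \<in> cube n" and "f x \<noteq> f y"
    and v: "FC_feasible n f x v" and w: "FC_feasible n f y w"
  shows "1 \<le> (\<Sum>i\<in>diff n x y. min (v i) (w i))"
proof -
  define z where "z = (\<lambda>i. if v i \<le> w i then y i else x i)"
  have z: "z \<in> cube n" unfolding z_def using y x by (rule if_in_cube)
  have nonneg: "0 \<le> min (v i) (w i)" if "i \<in> {1..n}" for i
    using v w that unfolding FC_feasible_def by simp
  consider "f z \<noteq> f x" | "f z \<noteq> f y" using assms(3) by metis
  then show ?thesis
  proof cases
    case 1
    with v z have "1 \<le> (\<Sum>i\<in>diff n x z. v i)"
      by (rule FC_feasible_sum_ge_1)
    \<comment> \<open>\<open>z\<close> leaves \<open>x\<close> only where
      \<open>v i \<le> w i\<close>, and there the minimum is \<open>v i\<close>; the other case is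
      symmetric.\<close>
    also have "\<dots> = (\<Sum>i\<in>diff n x z. min (v i) (w i))"
      by (intro sum.cong) (auto simp: z_def split: if_splits)
    also have "\<dots> \<le> (\<Sum>i\<in>diff n x y. min (v i) (w i))"
      using nonneg by (intro sum_mono2) (auto simp: z_def)
    finally show ?thesis .
  next
    case 2
    with w z have "1 \<le> (\<Sum>i\<in>diff n y z. w i)"
      by (rule FC_feasible_sum_ge_1)
    also have "\<dots> = (\<Sum>i\<in>diff n y z. min (v i) (w i))"
      by (intro sum.cong) (auto simp: z_def split: if_splits)
    also have "\<dots> \<le> (\<Sum>i\<in>diff n x y. min (v i) (w i))"
      using nonneg by (intro sum_mono2) (auto simp: z_def)
    finally show ?thesis .
  qed
qed

lemma min_le_sqrt_mult:
  fixes a b :: real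
  assumes "0 \<le> a" "0 \<le> b"
  shows "min a b \<le> sqrt a * sqrt b"
proof -
  have "min a b = sqrt (min a b) * sqrt (min a b)" using assms by simp
  also have "\<dots> \<le> sqrt a * sqrt b" using assms by (intro mult_mono) auto
  finally show ?thesis .
qed

lemma EC_feasible_sqrt:
  assumes v: "\<And>x. x \<in> cube n \<Longrightarrow> FC_feasible n f x (v x)"
    and le_1: "\<And>x i. x \<in> cube n \<Longrightarrow> i \<in> {1..n} \<Longrightarrow> v x i \<le> 1"
  shows "EC_feasible n f (\<lambda>x i. sqrt (v x i))"
  unfolding EC_feasible_def
proof (intro conjI ballI impI)
  fix x y assume xy: "x \<in> cube n" "y \<in> cube n" "f x \<noteq> f y"
  have "1 \<le> (\<Sum>i\<in>diff n x y. min (v x i) (v y i))"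
    using xy v[OF xy(1)] v[OF xy(2)] by (rule sum_min_ge_1)
  also have "\<dots> \<le> (\<Sum>i\<in>diff n x y. sqrt (v x i) * sqrt (v y i))"
    using v xy unfolding FC_feasible_def by (intro sum_mono min_le_sqrt_mult) auto
  finally show "1 \<le> (\<Sum>i\<in>diff n x y. sqrt (v x i) * sqrt (v y i))" .
qed (use v le_1 in \<open>auto simp: FC_feasible_def\<close>)

lemma EC_le:
  assumes w: "EC_feasible n f w" and c: "\<And>x. x \<in> cube n \<Longrightarrow> (\<Sum>i=1..n. w x i) \<le> c"
  shows "EC n f \<le> c"
proof -
  have nonneg: "0 \<le> Max ((\<lambda>x. \<Sum>i=1..n. w x i) ` cube n)" if "EC_feasible n f w" for w
  proof -
    obtain x where x: "x \<in> cube n" using cube_nonempty by blast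
    then have "0 \<le> (\<Sum>i=1..n. w x i)"
      using that unfolding EC_feasible_def by (intro sum_nonneg) auto
    also have "\<dots> \<le> Max ((\<lambda>x. \<Sum>i=1..n. w x i) ` cube n)"
      using x finite_cube by (intro Max_ge) auto
    finally show ?thesis .
  qed
  have "EC n f \<le> Max ((\<lambda>x. \<Sum>i=1..n. w x i) ` cube n)"
    unfolding EC_def
    by (intro cInf_lower bdd_belowI[of _ 0]) (use w nonneg in auto)
  also have "\<dots> \<le> c"
    using c cube_nonempty[of n] finite_cube[of n] by (subst Max_le_iff) auto
  finally show ?thesis .
qed

text \<open>From \<open>1 / F\<close> on, the linear function \<open>sqrt F * t\<close> dominates
  the square root. Weights bounded below thus grow in sum by at most the factor
  \<open>sqrt F\<close>.\<close>

lemma sqrt_le_mult_sqrt: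
  fixes F t :: real
  assumes "0 < F" "0 \<le> t" "1 / F \<le> t"
  shows "sqrt t \<le> sqrt F * t"
proof -
  have "1 \<le> F * t" using assms by (simp add: field_simps)
  then have "sqrt t * 1 \<le> sqrt t * sqrt (F * t)"
    using assms by (intro mult_left_mono) auto
  also have "\<dots> = sqrt F * t" using assms by (simp add: real_sqrt_mult)
  finally show ?thesis by simp
qed

text \<open>The 4 is a product of two 2s: one from near-optimal instead of optimal certificates, one
  from doubling the weights that are kept.\<close>

theorem EC_le_FC: "EC n f \<le> 4 * FC n f powr (3/2)"
proof (cases "\<exists>x\<in>cube n. \<exists>y\<in>cube n. f x \<noteq> f y")
  \<comment> \<open>For \<open>f\<close> constant on the cube the zero weights are feasible. The
    other case divides by \<open>FC n f\<close> and uses that it is at least 1.\<close>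
  case False
  then have const: "f x = f y" if "x \<in> cube n" "y \<in> cube n" for x y using that by blast
  have "EC_feasible n f (\<lambda>x i. 0)"
    unfolding EC_feasible_def by (intro conjI ballI impI) (use const in blast, simp_all)
  then have "EC n f \<le> 0" by (rule EC_le) simp
  then show ?thesis using powr_ge_zero[of "FC n f" "3/2"] by linarith
next
  case True
  define F where "F = FC n f"
  obtain x y where "x \<in> cube n" "y \<in> cube n" "f x \<noteq> f y" using True by blast
  then have F: "1 \<le> F" unfolding F_def by (rule FC_ge_1)
  \<comment> \<open>As \<open>F\<close> is positive, \<open>2 * F\<close> lies strictly above the
    infimum \<open>FC_at n f x\<close>.\<close>
  have "\<exists>v. FC_feasible n f x v \<and> (\<Sum>i=1..n. v i) < 2 * F" if x: "x \<in> cube n" for x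
  proof -
    have "FC_at n f x < 2 * F" using FC_at_le_FC[OF x, of f] F unfolding F_def by linarith
    then show ?thesis using FC_at_approx[OF x] by metis
  qed
  then obtain v where v: "\<And>x. x \<in> cube n \<Longrightarrow> FC_feasible n f x (v x)"
    and sum_v: "\<And>x. x \<in> cube n \<Longrightarrow> (\<Sum>i=1..n. v x i) < 2 * F"
    by metis
  define u where "u x i = min 1 (if 1 / (2 * F) \<le> v x i then 2 * v x i else 0)" for x i
  have u: "FC_feasible n f x (u x)" if "x \<in> cube n" for x
    unfolding u_def using that v F
    by (intro FC_feasible_min_1 FC_feasible_remove_small) (auto simp: F_def)
  have "EC_feasible n f (\<lambda>x i. sqrt (u x i))"
    using u by (rule EC_feasible_sqrt) (auto simp: u_def)
  then have "EC n f \<le> 4 * (F * sqrt F)"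
  proof (rule EC_le)
    fix x assume x: "x \<in> cube n"
    have v_nonneg: "0 \<le> v x i" if "i \<in> {1..n}" for i
      using v[OF x] that unfolding FC_feasible_def by blast
    have "sqrt (u x i) \<le> sqrt F * (2 * v x i)" if i: "i \<in> {1..n}" for i
    proof (cases "1 / (2 * F) \<le> v x i")
      case True
      then have "1 / F \<le> 2 * v x i" using F by (simp add: field_simps)
      \<comment> \<open>Both arguments of the cap reach \<open>1 / F\<close>: the doubled weight by
        the threshold, and 1 because \<open>F\<close> is at least 1.\<close>
      then have "1 / F \<le> u x i" using True F by (simp add: u_def)
      then have "sqrt (u x i) \<le> sqrt F * u x i"
        using F v_nonneg[OF i] by (intro sqrt_le_mult_sqrt) (auto simp: u_def)
      also have "\<dots> \<le> sqrt F * (2 * v x i)"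
        using F True by (intro mult_left_mono) (auto simp: u_def)
      finally show ?thesis .
    next
      case False
      then show ?thesis using F v_nonneg[OF i] by (simp add: u_def)
    qed
    then have "(\<Sum>i=1..n. sqrt (u x i)) \<le> (\<Sum>i=1..n. sqrt F * (2 * v x i))"
      by (rule sum_mono)
    also have "\<dots> = 2 * sqrt F * (\<Sum>i=1..n. v x i)"
      by (simp add: sum_distrib_left mult_ac)
    also have "\<dots> \<le> 2 * sqrt F * (2 * F)"
      using sum_v[OF x] F by (intro mult_left_mono) auto
    finally show "(\<Sum>i=1..n. sqrt (u x i)) \<le> 4 * (F * sqrt F)" by (simp add: mult_ac)
  qed
  also have "F * sqrt F = F powr (3/2)"
    using F powr_add[of F 1 "1/2"] by (simp add: powr_half_sqrt)
  finally show ?thesis unfolding F_def .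
qed

section \<open>Fractional certificates from randomized algorithms\<close>

text \<open>A set rather than a list: repeated queries of a position count once, hence only an
  inequality in \<open>card_dtree_path_le\<close>.\<close>

primrec dtree_path :: "'i dtree \<Rightarrow> ('i \<Rightarrow> bool) \<Rightarrow> 'i set" where
  "dtree_path (Leaf b) x = {}"
| "dtree_path (Query i T0 T1) x = insert i (if x i then dtree_path T1 x else dtree_path T0 x)"

lemma dtree_path_subset: "dtree_path T x \<subseteq> queried T"
  by (induction T) auto

lemma finite_dtree_path: "finite (dtree_path T x)"
  by (induction T) auto

lemma card_dtree_path_le: "card (dtree_path T x) \<le> dtree_cost T x"
  by (induction T) (auto simp: card_insert_if finite_dtree_path)

lemma dtree_output_cong:
  "(\<And>i. i \<in> dtree_path T x \<Longrightarrow> x i = y i) \<Longrightarrow> dtree_output T x = dtree_output T y"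
  by (induction T) (auto split: if_splits)

lemma dtree_cost_le_size: "dtree_cost T x \<le> size T"
  by (induction T) auto

text \<open>The hypothesis on \<open>g\<close> says that it depends only on coordinates in
  \<open>S\<close>. The tree queries one of them and continues with a tree for \<open>g\<close> with
  that coordinate fixed.\<close>

lemma exists_dtree:
  assumes "finite S" "\<And>x y. (\<And>i. i \<in> S \<Longrightarrow> x i = y i) \<Longrightarrow> g x = g y"
  shows "\<exists>T. queried T \<subseteq> S \<and> (\<forall>x. dtree_output T x = g x)"
  using assms
proof (induction S arbitrary: g rule: finite_induct)
  case empty
  have "dtree_output (Leaf (g undefined)) x = g x" for x
    using empty.prems[of undefined x] by simp
  then show ?case by (intro exI[of _ "Leaf (g undefined)"]) simp
next
  case (insert j S)
  have "\<exists>T. queried T \<subseteq> S \<and> (\<forall>x. dtree_output T x = g (x(j := b)))" for b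
  proof (rule insert.IH)
    fix x y :: "'a \<Rightarrow> bool" assume "\<And>i. i \<in> S \<Longrightarrow> x i = y i"
    then show "g (x(j := b)) = g (y(j := b))" by (intro insert.prems) auto
  qed
  then obtain T where T: "\<And>b. queried (T b) \<subseteq> S"
      "\<And>b x. dtree_output (T b) x = g (x(j := b))"
    by metis
  have "dtree_output (Query j (T False) (T True)) x = g x" for x
    using fun_upd_triv[of x j] by (cases "x j") (auto simp: T(2))
  then show ?case
    using T(1) by (intro exI[of _ "Query j (T False) (T True)"]) auto
qed

text \<open>Ensures that the \<open>LEAST\<close> in the definition of \<open>R\<close> ranges over
  a nonempty set.\<close>

lemma exists_randomized_alg:
  "\<exists>d A. randomized_alg n A \<and> computes n A f \<and> worst_case_cost n A = enat d"
proof -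
  \<comment> \<open>\<open>f\<close> may depend on values outside \<open>{1..n}\<close>; composing
    with \<open>restrict\<close> removes this dependence and changes nothing on the cube.\<close>
  have "\<exists>T. queried T \<subseteq> {1..n} \<and> (\<forall>x. dtree_output T x = f (restrict x {1..n}))"
  proof (rule exists_dtree)
    fix x y :: "nat \<Rightarrow> bool" assume "\<And>i. i \<in> {1..n} \<Longrightarrow> x i = y i"
    then show "f (restrict x {1..n}) = f (restrict y {1..n})"
      by (intro arg_cong[of _ _ f] restrict_ext)
  qed simp
  then obtain T where T: "queried T \<subseteq> {1..n}" "\<And>x. dtree_output T x = f (restrict x {1..n})"
    by blast
  have "worst_case_cost n (return_pmf T) \<le> enat (size T)"
    unfolding worst_case_cost_def by (auto intro!: SUP_least simp: dtree_cost_le_size)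
  then obtain d where "worst_case_cost n (return_pmf T) = enat d"
    using enat_ile by blast
  moreover have "randomized_alg n (return_pmf T)"
    using T(1) by (simp add: randomized_alg_def)
  moreover have "restrict x {1..n} = x" if "x \<in> cube n" for x
    using that unfolding cube_def by (simp add: PiE_restrict)
  then have "computes n (return_pmf T) f"
    unfolding computes_def by (simp add: T(2))
  ultimately show ?thesis by blast
qed

lemma R_attained:
  obtains A where "randomized_alg n A" "computes n A f" "worst_case_cost n A = enat (R n f)"
  using LeastI_ex[OF exists_randomized_alg[of n f]] unfolding R_def by blast

text \<open>A tree that is correct on both \<open>x\<close> and \<open>y\<close> must query, on
  input \<open>x\<close>, a position where they differ. The two error probabilities leave at least
  1/3 for this event; a union bound over positions and the factor 3 give the constraint.\<close>

lemma FC_feasible_query_prob: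
  assumes x: "x \<in> cube n" and A: "computes n A f" "randomized_alg n A"
  shows "FC_feasible n f x (\<lambda>i. 3 * measure_pmf.prob A {T. i \<in> dtree_path T x})"
  unfolding FC_feasible_def
proof (intro conjI ballI impI)
  fix y assume y: "y \<in> cube n" "f y \<noteq> f x"
  let ?E = "\<lambda>i. {T. i \<in> dtree_path T x}"
  let ?X = "{T. dtree_output T x \<noteq> f x}" and ?Y = "{T. dtree_output T y \<noteq> f y}"
  have "\<exists>i\<in>diff n x y. T \<in> ?E i" if T: "T \<in> set_pmf A" "T \<notin> ?X" "T \<notin> ?Y" for T
  proof (rule ccontr)
    assume *: "\<not> ?thesis"
    have "dtree_path T x \<subseteq> {1..n}"
      using dtree_path_subset[of T x] A(2) T(1) unfolding randomized_alg_def by blast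
    then have "dtree_output T x = dtree_output T y"
      using * by (intro dtree_output_cong) blast
    then show False using T y(2) by simp
  qed
  then have "AE T in A. T \<in> UNIV \<longrightarrow> T \<in> ?X \<union> ?Y \<union> (\<Union>i\<in>diff n x y. ?E i)"
    unfolding AE_measure_pmf_iff by blast
  then have "measure_pmf.prob A UNIV \<le> measure_pmf.prob A (?X \<union> ?Y \<union> (\<Union>i\<in>diff n x y. ?E i))"
    by (intro measure_pmf.finite_measure_mono_AE) auto
  then have "1 \<le> measure_pmf.prob A (?X \<union> ?Y \<union> (\<Union>i\<in>diff n x y. ?E i))"
    by simp
  also have "\<dots> \<le> measure_pmf.prob A (?X \<union> ?Y) + measure_pmf.prob A (\<Union>i\<in>diff n x y. ?E i)"
    by (rule measure_Un_le) auto
  also have "\<dots> \<le> measure_pmf.prob A ?X + measure_pmf.prob A ?Y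
      + measure_pmf.prob A (\<Union>i\<in>diff n x y. ?E i)"
    using measure_Un_le[of ?X "measure_pmf A" ?Y] by simp
  also have "\<dots> \<le> 1 / 3 + 1 / 3 + (\<Sum>i\<in>diff n x y. measure_pmf.prob A (?E i))"
    using A(1) x y(1) unfolding computes_def
    by (intro add_mono measure_pmf.finite_measure_subadditive_finite) auto
  finally have "1 \<le> 3 * (\<Sum>i\<in>diff n x y. measure_pmf.prob A (?E i))" by simp
  then show "1 \<le> (\<Sum>i\<in>diff n x y. 3 * measure_pmf.prob A (?E i))"
    by (simp add: sum_distrib_left)
qed simp

text \<open>By linearity of expectation the sum is the expected number of distinct positions in
  \<open>{1..n}\<close> queried on \<open>x\<close>, and every tree in the support makes at most
  \<open>d\<close> queries.\<close>

lemma sum_query_prob_le: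
  assumes x: "x \<in> cube n" and A: "worst_case_cost n A = enat d"
  shows "(\<Sum>i=1..n. measure_pmf.prob A {T. i \<in> dtree_path T x}) \<le> real d"
proof -
  let ?I = "\<lambda>i T. indicator {T. i \<in> dtree_path T x} T :: real"
  have int: "integrable (measure_pmf A) (?I i)" for i
    by (intro measure_pmf.integrable_const_bound[where B = 1]) (auto simp: indicator_def)
  have le: "(\<Sum>i=1..n. ?I i T) \<le> real d" if T: "T \<in> set_pmf A" for T
  proof -
    have "enat (dtree_cost T x) \<le> worst_case_cost n A"
      unfolding worst_case_cost_def using T x by (intro SUP_upper2[of T] SUP_upper) auto
    then have "dtree_cost T x \<le> d" using A by simp
    moreover have "card ({1..n} \<inter> dtree_path T x) \<le> card (dtree_path T x)"
      by (intro card_mono finite_dtree_path) auto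
    moreover have "(\<Sum>i=1..n. ?I i T) = real (card ({1..n} \<inter> dtree_path T x))"
      by (simp add: indicator_def)
    ultimately show ?thesis using card_dtree_path_le[of T x] by simp
  qed
  have "(\<Sum>i=1..n. measure_pmf.prob A {T. i \<in> dtree_path T x})
      = (\<Sum>i=1..n. measure_pmf.expectation A (?I i))"
    by simp
  also have "\<dots> = measure_pmf.expectation A (\<lambda>T. \<Sum>i=1..n. ?I i T)"
    using int by (intro Bochner_Integration.integral_sum[symmetric]) auto
  also have "\<dots> \<le> real d"
    using int le by (intro measure_pmf.integral_le_const) (auto simp: AE_measure_pmf_iff)
  finally show ?thesis .
qed

theorem FC_le_R: "FC n f \<le> 3 * real (R n f)"
proof -
  obtain A where A: "randomized_alg n A" "computes n A f" "worst_case_cost n A = enat (R n f)"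
    by (rule R_attained)
  have "FC_at n f x \<le> 3 * real (R n f)" if x: "x \<in> cube n" for x
  proof -
    have "FC_at n f x \<le> (\<Sum>i=1..n. 3 * measure_pmf.prob A {T. i \<in> dtree_path T x})"
      using FC_feasible_query_prob[OF x A(2,1)] by (rule FC_at_le)
    also have "\<dots> \<le> 3 * real (R n f)"
      using sum_query_prob_le[OF x A(3)] by (simp add: sum_distrib_left[symmetric])
    finally show ?thesis .
  qed
  then show ?thesis
    unfolding FC_def using finite_cube[of n] cube_nonempty[of n] by (subst Max_le_iff) auto
qed

section \<open>A common constant for the three bounds\<close>

theorem corollary9:
  "\<exists>K::real. K > 0 \<and>
     (\<forall>n::nat. n \<ge> 1 \<longrightarrow> (\<forall>f :: (nat \<Rightarrow> bool) \<Rightarrow> bool.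
        EC n f \<le> K * FC n f powr (3/2) \<and>
        EC n f \<le> K * real (R n f) powr (3/2) \<and>
        FC n f powr (3/2) \<le> K * real (R n f) powr (3/2)))"
proof -
  \<comment> \<open>\<open>c\<close> is what the factor 3 in \<open>FC_le_R\<close> becomes under
    the power 3/2. Since \<open>c\<close> is at least 1, the single constant \<open>4 * c\<close>
    covers all three inequalities.\<close>
  define c :: real where "c = 3 powr (3/2)"
  have c: "1 \<le> c" unfolding c_def by (intro ge_one_powr_ge_zero) auto
  have "EC n f \<le> 4 * c * FC n f powr (3/2) \<and> EC n f \<le> 4 * c * real (R n f) powr (3/2) \<and>
      FC n f powr (3/2) \<le> 4 * c * real (R n f) powr (3/2)" for n f
  proof -
    let ?F = "FC n f powr (3/2)" and ?R = "real (R n f) powr (3/2)"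
    have "?F \<le> (3 * real (R n f)) powr (3/2)"
      using FC_le_R FC_nonneg by (intro powr_mono2) auto
    also have "\<dots> = c * ?R" unfolding c_def by (simp add: powr_mult)
    finally have F: "?F \<le> c * ?R" .
    have "?F \<le> c * ?F" using mult_right_mono[OF c, of ?F] by simp
    moreover have "0 \<le> c * ?R" using c by simp
    ultimately show ?thesis using EC_le_FC[of n f] F by linarith
  qed
  then show ?thesis using c by (intro exI[of _ "4 * c"]) auto
qed

end
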